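(* Let $G=\mathrm{L}_2(q)$, where $q\geqslant 4$ is a prime power, and consider the action of $G$ on $\Omega=G/H$, where $H$ is a subgroup of type $\mathrm{GL}_1(q)\wr S_2$. Then for all $\alpha,\beta\in\Omega$, the set $\Sigma(\alpha)$ meets every regular $G_\beta$-orbit on $\Omega$.
   Context: $\mathrm{L}_2(q)=\mathrm{PSL}_2(q)$. A subgroup of type $\mathrm{GL}_1(q)\wr S_2$ is the stabiliser in $G$ of a decomposition $V=V_1\oplus V_2$ of the natural module $V=\mathbb{F}_q^2$ into two 1-dimensional subspaces, so $\Omega$ may be identified with the set of unordered pairs of distinct 1-dimensional subspaces of $V$. For $\alpha\in\Omega$, $\Sigma(\alpha)=\{\gamma\in\Omega: G_\alpha\cap G_\gamma=1\}$ is the set of neighbours of $\alpha$ in the Saxl graph of $G$ (vertex set $\Omega$, edges the 2-element bases of $G$); it is the union of the regular $G_\alpha$-orbits. *)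

theory Defs
  imports "HOL-Analysis.Analysis" "HOL-Algebra.Group_Action" "HOL-Algebra.Left_Coset"
begin

definition centre :: "('g, 'm) monoid_scheme \<Rightarrow> 'g set" where
  "centre G = {z \<in> carrier G. \<forall>g \<in> carrier G. z \<otimes>\<^bsub>G\<^esub> g = g \<otimes>\<^bsub>G\<^esub> z}"

definition SL2 :: "('a::{field,finite}^2^2) monoid" where
  "SL2 = \<lparr>carrier = {A. det A = 1}, mult = (**), one = mat 1\<rparr>"

text \<open>The elements of \<open>PSL2\<close> are cosets of the centre of \<open>SL2\<close>, that is, sets of matrices.
  The field is the type \<open>'a\<close>, so \<open>q = CARD('a)\<close>.\<close>

definition PSL2 :: "('a::{field,finite}^2^2) set monoid" where
  "PSL2 = SL2 Mod centre SL2"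

text \<open>The decompositions of the natural module as a direct sum of two 1-dimensional subspaces,
  as unordered pairs of subspaces.\<close>

definition decompositions :: "('a::{field,finite}^2) set set set" where
  "decompositions = {{U, W} | U W.
     vec.subspace U \<and> vec.subspace W \<and> vec.dim U = 1 \<and> vec.dim W = 1 \<and>
     U \<inter> W = {0} \<and> {u + w | u w. u \<in> U \<and> w \<in> W} = UNIV}"

text \<open>The matrices in an element \<open>g\<close> of \<open>PSL2\<close> differ by scalars, so they all have the
  same image \<open>A U\<close> on a subspace \<open>U\<close>, and the union below is just \<open>A U\<close> for any of them.\<close>

definition subspace_act :: "('a::{field,finite}^2^2) set \<Rightarrow> ('a^2) set \<Rightarrow> ('a^2) set" where
  "subspace_act g U = (\<Union>A \<in> g. (*v) A ` U)"

definition decomp_act ::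
    "('a::{field,finite}^2^2) set \<Rightarrow> ('a^2) set set \<Rightarrow> ('a^2) set set" where
  "decomp_act g = (\<lambda>D \<in> decompositions. subspace_act g ` D)"

definition GL1_wr_S2_type :: "('a::{field,finite}^2^2) set set \<Rightarrow> bool" where
  "GL1_wr_S2_type H \<longleftrightarrow> (\<exists>D \<in> decompositions. H = stabilizer PSL2 decomp_act D)"

definition coset_act :: "('g, 'm) monoid_scheme \<Rightarrow> 'g set \<Rightarrow> 'g \<Rightarrow> 'g set \<Rightarrow> 'g set" where
  "coset_act G H g = (\<lambda>C \<in> lcosets\<^bsub>G\<^esub> H. g <#\<^bsub>G\<^esub> C)"

text \<open>The neighbours of \<open>\<alpha>\<close> in the Saxl graph of \<open>G\<close> acting on \<open>\<Omega>\<close> via \<open>\<phi>\<close>.\<close>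

definition saxl_nbrs ::
    "('g, 'm) monoid_scheme \<Rightarrow> 'x set \<Rightarrow> ('g \<Rightarrow> 'x \<Rightarrow> 'x) \<Rightarrow> 'x \<Rightarrow> 'x set" where
  "saxl_nbrs G \<Omega> \<phi> \<alpha> =
     {\<gamma> \<in> \<Omega>. stabilizer G \<phi> \<alpha> \<inter> stabilizer G \<phi> \<gamma> = {\<one>\<^bsub>G\<^esub>}}"

definition regular_orbits ::
    "('g, 'm) monoid_scheme \<Rightarrow> 'x set \<Rightarrow> ('g \<Rightarrow> 'x \<Rightarrow> 'x) \<Rightarrow> 'x set set" where
  "regular_orbits G \<Omega> \<phi> =
     {R \<in> orbits G \<Omega> \<phi>. \<forall>x \<in> R. \<forall>y \<in> R. \<exists>!g. g \<in> carrier G \<and> \<phi> g x = y}"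

definition point_stabilizer ::
    "('g, 'm) monoid_scheme \<Rightarrow> ('g \<Rightarrow> 'x \<Rightarrow> 'x) \<Rightarrow> 'x \<Rightarrow> ('g, 'm) monoid_scheme" where
  "point_stabilizer G \<phi> \<beta> = G\<lparr>carrier := stabilizer G \<phi> \<beta>\<rparr>"

end

theory Submission
  imports Defs
begin

text \<open>Mapping the coset gH to g D_0, where H is the stabiliser of D_0, turns the claim into one
  about unordered pairs of points of the projective line: if \<beta> and \<gamma> have trivial common
  stabiliser, then so do \<alpha> and some pair in the G_\<beta>-orbit of \<gamma>. Let
  \<beta> = {0, \<infinity>}. Two pairs sharing exactly one point always have trivial common stabiliser,
  and disjoint pairs [u], [v] and [r], [s] do if the negated product of the four determinants
  det(u,r), det(u,s), det(v,r), det(v,s) is a nonsquare.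

  If \<gamma> = {c, d} is disjoint from \<beta>, then -cd is a nonsquare, the orbit consists of
  all {tc, td} with t \<noteq> 0, and one of these shares exactly one point with \<alpha> unless
  \<alpha> = \<beta>, when \<gamma> itself works.

  If \<gamma> = {0, c}, then the orbit consists of the pairs {0, s c} and {\<infinity>, -s c}
  for nonzero squares s. One of them shares exactly one point with \<alpha> except when
  \<alpha> = {a, b} with a/c, b/c, -a/c, -b/c all nonsquares. Then -1 and ab are squares,
  and the pair {0, x} works as soon as (x - a)(x - b) is a nonsquare. With c = 1, such a square
  x exists because t \<mapsto> (a - bt)/(1 - t) is injective on the nonsquares t and omits the
  nonsquare a, so it maps some nonsquare to a square.\<close>

section \<open>Squares in finite fields\<close>

text \<open>Squaring is at most two-to-one, so the set \<open>S\<close> of nonzero squares has at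
  least half of the nonzero elements. Were \<open>a * b\<close> a nonsquare, then \<open>S\<close>,
  its disjoint multiple by \<open>a\<close> and the element \<open>a * b\<close> would be too
  many.\<close>

lemma finite_field_nonsquares_mult:
  fixes a b :: "'a::{field,finite}"
  assumes a: "a \<notin> range (\<lambda>x. x^2)" and b: "b \<notin> range (\<lambda>x. x^2)"
  shows "a * b \<in> range (\<lambda>x. x^2)"
proof (rule ccontr)
  assume ab: "a * b \<notin> range (\<lambda>x. x^2)"
  define S where "S = (\<lambda>x::'a. x^2) ` (UNIV - {0})"
  have a0: "a \<noteq> 0" and b0: "b \<noteq> 0" using a b by (metis rangeI zero_power2)+
  have fib: "card {x::'a. x^2 = s} \<le> 2" for s
  proof (cases "\<exists>y. y^2 = s")
    case True
    then obtain y where "y^2 = s" by blast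
    then have "{x. x^2 = s} \<subseteq> {y, -y}" by (auto simp: power2_eq_iff)
    then have "card {x. x^2 = s} \<le> card {y, -y}" by (intro card_mono) auto
    also have "\<dots> \<le> 2" by (simp add: card_insert_if)
    finally show ?thesis .
  qed simp
  have "UNIV - {0} \<subseteq> (\<Union>s\<in>S. {x::'a. x^2 = s})" by (auto simp: S_def)
  then have "card (UNIV - {0::'a}) \<le> card (\<Union>s\<in>S. {x::'a. x^2 = s})" by (intro card_mono) auto
  also have "\<dots> \<le> (\<Sum>s\<in>S. card {x::'a. x^2 = s})" by (rule card_UN_le) simp
  also have "\<dots> \<le> card S * 2" using fib sum_bounded_above[of S "\<lambda>s. card {x::'a. x^2 = s}" 2] by simp
  finally have upper: "card (UNIV - {0::'a}) \<le> card S * 2" .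
  have cardaS: "card ((*) a ` S) = card S" using a0 by (intro card_image) (auto simp: inj_on_def)
  have "a * y^2 \<noteq> x^2" if "y \<noteq> 0" for x y
  proof
    assume "a * y^2 = x^2"
    then have "a = (x / y)^2" using that by (simp add: field_simps)
    then show False using a by blast
  qed
  then have "S \<inter> (*) a ` S = {}" by (fastforce simp: S_def)
  moreover have "a * b \<notin> S \<union> (*) a ` S" using ab b a0 by (auto simp: S_def)
  ultimately have "card (insert (a * b) (S \<union> (*) a ` S)) = 2 * card S + 1"
    by (simp add: card_Un_disjoint cardaS)
  moreover have "insert (a * b) (S \<union> (*) a ` S) \<subseteq> UNIV - {0}" using a0 b0 by (auto simp: S_def)
  ultimately show False using upper card_mono[of "UNIV - {0::'a}" "insert (a * b) (S \<union> (*) a ` S)"] by simp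
qed

text \<open>The map \<open>f\<close> is inverse to x \<mapsto> (x - a) / (x - b). For x =
  \<open>f t\<close> the product (x - a)(x - b) is therefore \<open>t\<close> times a nonzero
  square, so it is a nonsquare if \<open>t\<close> is. It remains to find a nonsquare
  \<open>t\<close> with \<open>f t\<close> a nonzero square.\<close>

lemma exists_square_with_nonsquare_product:
  fixes a b :: "'a::{field,finite}"
  assumes "a \<noteq> b" and a: "a \<notin> range (\<lambda>x. x^2)" and b: "b \<notin> range (\<lambda>x. x^2)"
  obtains t where "t \<noteq> 0" "(t^2 - a) * (t^2 - b) \<notin> range (\<lambda>x. x^2)"
proof -
  define N where "N = - range (\<lambda>x::'a. x^2)"
  define f where "f t = (a - b * t) / (1 - t)" for t
  have N: "t \<noteq> 0" "t \<noteq> 1" if "t \<in> N" for t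
    using that unfolding N_def by (metis ComplD rangeI zero_power2, metis ComplD rangeI one_power2)
  have "inj_on f N"
  proof (rule inj_onI)
    fix s t assume "s \<in> N" "t \<in> N" "f s = f t"
    then have "(a - b * s) * (1 - t) = (a - b * t) * (1 - s)" using N by (simp add: f_def field_simps)
    then have "(a - b) * (s - t) = 0" by (simp add: algebra_simps)
    then show "s = t" using assms(1) by simp
  qed
  have "a \<notin> f ` N"
  proof
    assume "a \<in> f ` N"
    then obtain t where t: "t \<in> N" "a = f t" by blast
    then have "a * (1 - t) = a - b * t" using N[of t] nonzero_eq_divide_eq[of "1 - t" a "a - b * t"] by (simp add: f_def)
    then have "(a - b) * t = 0" by (simp add: left_diff_distrib right_diff_distrib mult.commute)
    then show False using N[OF t(1)] assms(1) by simp
  qed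
  moreover have "a \<in> N" using a by (simp add: N_def)
  \<comment> \<open>An injective map of the finite set \<open>N\<close> into itself would be onto,
    but \<open>f\<close> omits \<open>a\<close>.\<close>
  ultimately have "\<not> f ` N \<subseteq> N"
    using endo_inj_surj[of N f] \<open>inj_on f N\<close> by auto
  then obtain t u where t: "t \<in> N" "f t = u^2" unfolding N_def by auto
  have ft: "f t - a = t * (a - b) / (1 - t)" "f t - b = (a - b) / (1 - t)"
    using N[OF t(1)] by (simp_all add: f_def field_simps)
  \<comment> \<open>If \<open>f t\<close> were 0, then \<open>a = b * t\<close> would be a product
    of two nonsquares and hence a square.\<close>
  have "u \<noteq> 0"
  proof
    assume "u = 0"
    then have "a = b * t" using t N[OF t(1)] by (simp add: f_def)
    moreover have "b * t \<in> range (\<lambda>x. x^2)"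
      using finite_field_nonsquares_mult[of b t] b t(1) by (simp add: N_def)
    ultimately show False using a by simp
  qed
  moreover have "(u^2 - a) * (u^2 - b) \<notin> range (\<lambda>x. x^2)"
  proof
    assume "(u^2 - a) * (u^2 - b) \<in> range (\<lambda>x. x^2)"
    then obtain z where "t * ((a - b) / (1 - t))^2 = z^2"
      unfolding t(2)[symmetric] ft by (auto simp: power2_eq_square mult.assoc)
    moreover have "(a - b) / (1 - t) \<noteq> 0" using N[OF t(1)] assms(1) by simp
    ultimately have "t = (z / ((a - b) / (1 - t)))^2"
      unfolding power_divide[of z] by (simp only: eq_divide_eq power_eq_0_iff) simp
    then show False using t(1) unfolding N_def by blast
  qed
  ultimately show thesis by (rule that)
qed

section \<open>Lines in the plane and decompositions\<close>

definition line :: "'a::field^2 \<Rightarrow> ('a^2) set" where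
  "line v = range (\<lambda>c. c *s v)"

text \<open>The determinant with columns \<open>u\<close> and \<open>v\<close>. Its vanishing is the
  test for linear dependence and so for equality of lines.\<close>

definition wedge :: "'a::field^2 \<Rightarrow> 'a^2 \<Rightarrow> 'a" where
  "wedge u v = u$1 * v$2 - u$2 * v$1"

text \<open>Unlike \<open>decomp_act\<close>, this is not restricted to
  \<open>decompositions\<close>, so the composition law holds without membership hypotheses.\<close>

definition move :: "'a::field^2^2 \<Rightarrow> ('a^2) set set \<Rightarrow> ('a^2) set set" where
  "move A D = (\<lambda>U. (*v) A ` U) ` D"

lemma wedge_mult: "wedge (A *v u) (A *v v) = det A * wedge u v"
  by (simp add: wedge_def det_2 matrix_vector_mult_def sum_2 algebra_simps)

lemma wedge_scale [simp]: "wedge (c *s u) v = c * wedge u v" "wedge u (c *s v) = c * wedge u v"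
  by (simp_all add: wedge_def algebra_simps)

lemma wedge_self [simp]: "wedge u u = 0" by (simp add: wedge_def)

lemma wedge_commute: "wedge u v = - wedge v u" by (simp add: wedge_def)

lemma wedge_nonzeroD: assumes "wedge u v \<noteq> 0" shows "u \<noteq> 0" "v \<noteq> 0"
  using assms by (auto simp: wedge_def)

lemma wedge_eq_0_iff:
  assumes "u \<noteq> 0"
  shows "wedge u v = 0 \<longleftrightarrow> (\<exists>c. v = c *s u)"
proof
  assume w: "wedge u v = 0"
  show "\<exists>c. v = c *s u"
  proof (cases "u$1 = 0")
    case True
    then have "u$2 \<noteq> 0" using assms by (auto simp: vec_eq_iff forall_2)
    then show ?thesis using w True
      by (intro exI[of _ "v$2 / u$2"]) (auto simp: vec_eq_iff forall_2 wedge_def field_simps)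
  next
    case False
    then show ?thesis using w
      by (intro exI[of _ "v$1 / u$1"]) (auto simp: vec_eq_iff forall_2 wedge_def field_simps)
  qed
qed auto

lemma mem_line: "v \<in> line v"
  unfolding line_def by (rule range_eqI[of _ _ 1]) simp

lemma line_scale: "c \<noteq> 0 \<Longrightarrow> line (c *s v) = line v"
proof -
  assume c: "c \<noteq> 0"
  have "d *s v \<in> line (c *s v)" for d
    unfolding line_def by (rule range_eqI[of _ _ "d / c"]) (simp add: c vector_smult_assoc)
  then show ?thesis by (auto simp: line_def vector_smult_assoc)
qed

lemma line_eq_iff:
  assumes "u \<noteq> 0" "v \<noteq> 0"
  shows "line u = line v \<longleftrightarrow> wedge u v = 0"
proof
  assume "line u = line v"
  then have "v \<in> line u" using mem_line by blast
  then show "wedge u v = 0" by (auto simp: line_def)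
next
  assume "wedge u v = 0"
  then obtain c where "v = c *s u" using wedge_eq_0_iff assms by blast
  moreover from this have "c \<noteq> 0" using assms by auto
  ultimately show "line u = line v" by (simp add: line_scale)
qed

text \<open>Used to turn \<open>line (A *v u) = line v\<close> into an equation
  \<open>A *v u = a *s v\<close> between vectors.\<close>

lemma line_eqD:
  assumes "line (u::'a::field^2) = line v"
  obtains c where "u = c *s v"
  using assms mem_line[of u] by (auto simp: line_def)

lemma image_line [simp]: "(*v) A ` line v = line (A *v v)"
  by (auto simp: line_def image_iff vector_scalar_commute)

lemma line_eq_span: "line v = vec.span {v}"
  by (auto simp: line_def vec.span_singleton)

lemma move_pair [simp]: "move A {line u, line v} = {line (A *v u), line (A *v v)}"
  by (simp add: move_def)

lemma move_move: "move A (move B D) = move (A ** B) D"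
  by (simp add: move_def image_image matrix_vector_mul_assoc)

lemma move_one [simp]: "move (mat 1) D = D"
  by (simp add: move_def)

text \<open>A one-dimensional subspace is the line of a nonzero vector, and two lines in the plane
  are complementary exactly when they are distinct. All later work uses this form by spanning
  vectors.\<close>

lemma decompositions_iff:
  fixes D :: "('a::{field,finite}^2) set set"
  shows "D \<in> decompositions \<longleftrightarrow> (\<exists>u v. wedge u v \<noteq> 0 \<and> D = {line u, line v})"
proof
  assume "D \<in> decompositions"
  then obtain U W where UW: "D = {U, W}" "vec.subspace U" "vec.subspace W" "vec.dim U = 1" "vec.dim W = 1"
      "U \<inter> W = {0}"
    by (auto simp: decompositions_def)
  have 1: "\<exists>v. v \<noteq> 0 \<and> U = line v" if U: "vec.subspace U" "vec.dim U = 1" for U :: "('a^2) set"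
  proof -
    obtain B where B: "B \<subseteq> U" "vec.independent B" "U \<subseteq> vec.span B" "card B = vec.dim U"
      using vec.basis_exists by blast
    then obtain v where v: "B = {v}" using U card_1_singletonE by metis
    have "U = line v" using B U v vec.span_minimal unfolding line_eq_span by blast
    moreover have "v \<noteq> 0" using B v by auto
    ultimately show ?thesis by blast
  qed
  obtain u where u: "u \<noteq> 0" "U = line u" using 1 UW by blast
  obtain w where w: "w \<noteq> 0" "W = line w" using 1 UW by blast
  have "u \<notin> W" using UW(6) u mem_line by blast
  then have "line u \<noteq> line w" using w mem_line by blast
  then show "\<exists>u v. wedge u v \<noteq> 0 \<and> D = {line u, line v}" using u w line_eq_iff UW(1) by blast
next
  assume "\<exists>u v. wedge u v \<noteq> 0 \<and> D = {line u, line v}"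
  then obtain u v where uv: "wedge u v \<noteq> 0" "D = {line u, line v}" by blast
  have dim: "vec.dim (line x) = 1" if "x \<noteq> 0" for x :: "'a^2"
    unfolding line_eq_span vec.dim_span using vec.dim_eq_card_independent[of "{x}"] that by simp
  have "line u \<inter> line v = {0}"
  proof -
    have "x = 0" if x: "x \<in> line u" "x \<in> line v" for x
    proof -
      obtain c d where "x = c *s u" "x = d *s v" using x unfolding line_def by blast
      then have "c * wedge u v = d * wedge v v" by (metis wedge_scale(1))
      then show ?thesis using uv(1) \<open>x = c *s u\<close> by simp
    qed
    moreover have "0 \<in> line u" "0 \<in> line v" by (auto simp: line_eq_span vec.span_zero)
    ultimately show ?thesis by blast
  qed
  moreover have "{x + y | x y. x \<in> line u \<and> y \<in> line v} = UNIV"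
  proof -
    \<comment> \<open>Cramer's rule gives the coordinates of \<open>z\<close> in the basis
      \<open>u\<close>, \<open>v\<close>.\<close>
    have "z = (wedge z v / wedge u v) *s u + (wedge u z / wedge u v) *s v" for z
    proof -
      have "wedge u v * z$i = wedge z v * u$i + wedge u z * v$i" for i
        using exhaust_2[of i] by (auto simp: wedge_def algebra_simps)
      then have "z$i = wedge z v / wedge u v * u$i + wedge u z / wedge u v * v$i" for i
        using uv(1) by (metis add_divide_distrib nonzero_mult_div_cancel_left times_divide_eq_left)
      then show ?thesis by (simp add: vec_eq_iff)
    qed
    then show ?thesis unfolding line_def by blast
  qed
  ultimately show "D \<in> decompositions" unfolding decompositions_def using uv dim wedge_nonzeroD[OF uv(1)]
    by (intro CollectI exI[of _ "line u"] exI[of _ "line v"]) (auto simp: line_eq_span)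
qed

lemma move_decompositions:
  fixes D :: "('a::{field,finite}^2) set set"
  assumes "det A = 1" "D \<in> decompositions"
  shows "move A D \<in> decompositions"
proof -
  obtain u v where uv: "wedge u v \<noteq> 0" "D = {line u, line v}" using assms(2) decompositions_iff by blast
  then have "wedge (A *v u) (A *v v) \<noteq> 0" using assms(1) by (simp add: wedge_mult)
  then show ?thesis unfolding decompositions_iff uv(2) move_pair by blast
qed

section \<open>Trivial common stabilisers\<close>

text \<open>Triviality of the common stabiliser in \<open>PSL2\<close>, expressed by representatives
  in \<open>SL2\<close>: the identity of the quotient is represented by the scalar matrices, and
  \<open>det A = 1\<close> forces \<open>c^2 = 1\<close>.\<close>

definition trivial_meet :: "('a::field^2) set set \<Rightarrow> ('a^2) set set \<Rightarrow> bool" where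
  "trivial_meet D E \<longleftrightarrow>
     (\<forall>A. det A = 1 \<longrightarrow> move A D = D \<longrightarrow> move A E = E \<longrightarrow> (\<exists>c. A = mat c))"

text \<open>Since \<open>A\<close> preserves \<open>wedge\<close>, any two of the three eigenvalues
  have product 1. Those of \<open>u\<close> and \<open>v\<close> are thus equal, and
  \<open>A\<close> acts as one scalar on a basis.\<close>

lemma scalar_if_three_eigenlines:
  assumes "wedge u v \<noteq> 0" "wedge u w \<noteq> 0" "wedge v w \<noteq> 0"
    and "det A = 1" "line (A *v u) = line u" "line (A *v v) = line v" "line (A *v w) = line w"
  shows "\<exists>c. A = mat c"
proof -
  obtain a b c where eq: "A *v u = a *s u" "A *v v = b *s v" "A *v w = c *s w"
    using assms(5-7) by (metis line_eqD)
  have "a * b = 1" "a * c = 1" "b * c = 1"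
    using assms(1-4) wedge_mult[of A u v] wedge_mult[of A u w] wedge_mult[of A v w] by (simp_all add: eq mult_ac)
  then have "b = a" by (metis mult.commute mult_cancel_left mult_zero_left zero_neq_one)
  have "A = mat a"
  proof -
    have 1: "A $ i $ 1 * u$1 + A $ i $ 2 * u$2 = a * u$i" for i
      using arg_cong[OF eq(1), of "\<lambda>x. x$i"] by (simp add: matrix_vector_mult_def sum_2)
    have 2: "A $ i $ 1 * v$1 + A $ i $ 2 * v$2 = a * v$i" for i
      using arg_cong[OF eq(2), of "\<lambda>x. x$i"] \<open>b = a\<close> by (simp add: matrix_vector_mult_def sum_2)
    \<comment> \<open>Cramer's rule solves the equations \<open>1\<close> and \<open>2\<close> for
      row \<open>i\<close> of \<open>A\<close>.\<close>
    have "wedge u v * A $ i $ 1 = a * (u$i * v$2 - v$i * u$2)"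
         "wedge u v * A $ i $ 2 = a * (v$i * u$1 - u$i * v$1)" for i
      using 1[of i] 2[of i] unfolding wedge_def by algebra+
    moreover have "a * (u$i * v$2 - v$i * u$2) = wedge u v * mat a $ i $ 1"
      "a * (v$i * u$1 - u$i * v$1) = wedge u v * mat a $ i $ 2" for i
      using exhaust_2[of i] by (auto simp: mat_def wedge_def algebra_simps)
    ultimately have "A $ i $ j = mat a $ i $ j" for i j
      using exhaust_2[of j] assms(1) by (metis mult_cancel_left)
    then show ?thesis by (simp add: vec_eq_iff)
  qed
  then show ?thesis by blast
qed

text \<open>The shared line is the only one in both pairs, so a matrix stabilising both pairs fixes
  it, and then also the other line of each pair.\<close>

lemma trivial_meet_if_share_line:
  assumes "wedge u v \<noteq> 0" "wedge u w \<noteq> 0" "wedge v w \<noteq> 0"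
  shows "trivial_meet {line u, line v} {line u, line w}"
  unfolding trivial_meet_def move_pair
proof (intro allI impI)
  fix A :: "'a^2^2"
  assume A: "det A = 1" "{line (A *v u), line (A *v v)} = {line u, line v}"
    "{line (A *v u), line (A *v w)} = {line u, line w}"
  have "line u \<noteq> line v" "line u \<noteq> line w" "line v \<noteq> line w"
    using assms by (simp_all add: line_eq_iff wedge_nonzeroD)
  then have "line (A *v u) = line u" "line (A *v v) = line v" "line (A *v w) = line w"
    using A(2,3) unfolding doubleton_eq_iff by metis+
  then show "\<exists>c. A = mat c" using scalar_if_three_eigenlines assms A(1) by blast
qed

text \<open>\<open>A\<close> preserves \<open>wedge\<close>, while exchanging its arguments changes
  the sign. The result says that \<open>A\<close> applied twice is multiplication by -1.\<close>

lemma swapped_eigenvalues: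
  assumes "wedge u v \<noteq> 0" "det A = 1" "line (A *v u) = line v" "line (A *v v) = line u"
  obtains a b where "A *v u = a *s v" "A *v v = b *s u" "a * b = -1"
proof -
  obtain a b where eq: "A *v u = a *s v" "A *v v = b *s u" using assms(3,4) by (metis line_eqD)
  have "a * b * wedge v u = wedge u v" using wedge_mult[of A u v] assms(2) by (simp add: eq mult_ac)
  then have "(a * b) * wedge u v = (-1) * wedge u v"
    using wedge_commute[of v u] by (metis add.inverse_inverse mult_minus_right mult_minus1)
  then have "a * b = -1" using assms(1) mult_cancel_right by blast
  then show thesis using that eq by blast
qed

text \<open>The swap of \<open>r\<close> and \<open>s\<close> makes the square of \<open>A\<close>
  equal to -1, so the eigenvalue \<open>a\<close> at \<open>u\<close> has square -1. Invariance of
  \<open>wedge\<close> makes the four-fold product a square, and \<open>a\<close> absorbs the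
  sign.\<close>

lemma square_if_fix_and_swap:
  assumes "wedge u v \<noteq> 0" "wedge r s \<noteq> 0" "wedge u r \<noteq> 0"
    and "det A = 1" "line (A *v u) = line u" "line (A *v v) = line v"
      "line (A *v r) = line s" "line (A *v s) = line r"
  shows "- (wedge u r * wedge u s * wedge v r * wedge v s) \<in> range (\<lambda>x. x^2)"
proof -
  obtain a b where ab: "A *v u = a *s u" "A *v v = b *s v" using assms(5,6) by (metis line_eqD)
  obtain c d where cd: "A *v r = c *s s" "A *v s = d *s r" "c * d = -1"
    using swapped_eigenvalues assms by metis
  have eqs: "a * b = 1" "a * c * wedge u s = wedge u r" "a * d * wedge u r = wedge u s"
    "b * c * wedge v s = wedge v r"
    using assms(1,4) wedge_mult[of A u v] wedge_mult[of A u r] wedge_mult[of A u s] wedge_mult[of A v r]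
    by (simp_all add: ab cd mult_ac)
  \<comment> \<open>Inserting one relation into the other amounts to applying \<open>A\<close>
    twice; this yields \<open>a^2 = -1\<close>.\<close>
  have "wedge u r = a * c * (a * d * wedge u r)" using eqs(2,3) by simp
  also have "\<dots> = (c * d) * (a^2 * wedge u r)" by (simp add: power2_eq_square mult_ac)
  finally have "(a^2 + 1) * wedge u r = 0" by (simp add: cd(3) distrib_right eq_neg_iff_add_eq_0 add.commute)
  then have "a^2 + 1 = 0" using assms(3) by simp
  then have "- (wedge u r * wedge u s * wedge v r * wedge v s) = (a * c * wedge u s * wedge v s)^2"
    using eqs cd(3) by algebra
  then show ?thesis by blast
qed

text \<open>A matrix stabilising both pairs fixes or swaps the lines of each. Whenever it swaps a
  pair, the negated product is a square, so it fixes all four lines, three of which already force it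
  to be scalar.\<close>

lemma trivial_meet_if_nonsquare:
  assumes uv: "wedge u v \<noteq> 0" and rs: "wedge r s \<noteq> 0" and ur: "wedge u r \<noteq> 0" and vr: "wedge v r \<noteq> 0"
    and ns: "- (wedge u r * wedge u s * wedge v r * wedge v s) \<notin> range (\<lambda>x. x^2)"
  shows "trivial_meet {line u, line v} {line r, line s}"
  unfolding trivial_meet_def move_pair
proof (intro allI impI)
  fix A :: "'a^2^2"
  assume A: "det A = 1" "{line (A *v u), line (A *v v)} = {line u, line v}"
    "{line (A *v r), line (A *v s)} = {line r, line s}"
  \<comment> \<open>The product is symmetric in the two pairs, so the fix-and-swap argument also
    applies with their roles exchanged.\<close>
  have ns': "- (wedge r u * wedge r v * wedge s u * wedge s v) \<notin> range (\<lambda>x. x^2)"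
  proof -
    have "wedge r u * wedge r v * wedge s u * wedge s v = wedge u r * wedge u s * wedge v r * wedge v s"
      by (simp add: wedge_def algebra_simps)
    then show ?thesis using ns by simp
  qed
  have ru: "wedge r u \<noteq> 0" using ur wedge_commute[of r u] by simp
  have fix_uv: "\<not> (line (A *v r) = line s \<and> line (A *v s) = line r)"
    if "line (A *v u) = line u" "line (A *v v) = line v"
    using square_if_fix_and_swap[OF uv rs ur A(1)] ns that by blast
  have swap_uv: "line (A *v r) = line s \<and> line (A *v s) = line r"
    if "line (A *v u) = line v" "line (A *v v) = line u"
    using square_if_fix_and_swap[OF rs uv ru A(1)] ns' that A(3) unfolding doubleton_eq_iff by blast
  have "\<not> (line (A *v u) = line v \<and> line (A *v v) = line u)"
  proof
    assume swap: "line (A *v u) = line v \<and> line (A *v v) = line u"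
    obtain a b where ab: "A *v u = a *s v" "A *v v = b *s u" "a * b = -1"
      using swapped_eigenvalues[OF uv A(1)] swap by metis
    obtain c d where cd: "A *v r = c *s s" "A *v s = d *s r" "c * d = -1"
      using swapped_eigenvalues[OF rs A(1)] swap_uv swap by metis
    \<comment> \<open>With both pairs swapped, \<open>A\<close> relates opposite factors of the
      product, which becomes \<open>c * d = -1\<close> times a square.\<close>
    have "a * c * wedge v s = wedge u r" "a * d * wedge v r = wedge u s"
      using A(1) wedge_mult[of A u r] wedge_mult[of A u s] by (simp_all add: ab cd mult_ac)
    then have "wedge u r * wedge u s * wedge v r * wedge v s
        = (a * c * wedge v s) * (a * d * wedge v r) * wedge v r * wedge v s"
      by (simp only:)
    also have "\<dots> = (c * d) * (a * wedge v r * wedge v s)^2"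
      by (simp add: power2_eq_square mult_ac)
    finally have "- (wedge u r * wedge u s * wedge v r * wedge v s) = (a * wedge v r * wedge v s)^2"
      by (simp add: cd(3))
    then show False using ns by blast
  qed
  then have "line (A *v u) = line u" "line (A *v v) = line v" "line (A *v r) = line r"
    using A(2,3) fix_uv unfolding doubleton_eq_iff by metis+
  then show "\<exists>c. A = mat c" using scalar_if_three_eigenlines[of u v r A] uv ur vr A(1) by blast
qed

section \<open>Affine coordinates on the projective line, and matrices stabilising {0,
  \<infinity>}\<close>

definition pt :: "'a::field \<Rightarrow> ('a^2) set" where "pt x = line (vector [x, 1])"

definition inf_pt :: "('a::field^2) set" where "inf_pt = line (vector [1, 0])"

lemma wedge_vector [simp]: "wedge (vector [a, b]) (vector [c, d]) = a * d - b * c"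
  by (simp add: wedge_def)

lemma vector2_eq_0 [simp]: "(vector [a, b] :: 'a::zero^2) = 0 \<longleftrightarrow> a = 0 \<and> b = 0"
  by (simp add: vec_eq_iff forall_2)

lemma pt_eq_iff [simp]: "pt x = pt y \<longleftrightarrow> x = y" "pt x \<noteq> inf_pt" "inf_pt \<noteq> pt x"
  by (simp_all add: pt_def inf_pt_def line_eq_iff)

lemma line_cases:
  assumes "v \<noteq> 0"
  obtains "line v = inf_pt" | x where "line v = pt x"
proof (cases "v$2 = 0")
  case True
  then have "line v = inf_pt" using assms
    by (simp add: inf_pt_def line_eq_iff wedge_def)
  then show ?thesis by (rule that)
next
  case False
  then have "line v = pt (v$1 / v$2)" using assms
    by (simp add: pt_def line_eq_iff wedge_def)
  then show ?thesis by (rule that)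
qed

lemma decomposition_cases:
  fixes D :: "('a::{field,finite}^2) set set"
  assumes "D \<in> decompositions"
  obtains x where "D = {inf_pt, pt x}" | x y where "x \<noteq> y" "D = {pt x, pt y}"
proof -
  obtain u v where uv: "wedge u v \<noteq> 0" "D = {line u, line v}" using assms decompositions_iff by blast
  then have "u \<noteq> 0" "v \<noteq> 0" "line u \<noteq> line v" using wedge_nonzeroD line_eq_iff by blast+
  then obtain x y where "line u = inf_pt \<or> line u = pt x" "line v = inf_pt \<or> line v = pt y"
    using line_cases by metis
  then show thesis using that(1)[of x] that(1)[of y] that(2)[of x y] uv(2) \<open>line u \<noteq> line v\<close>
    by (metis insert_commute)
qed

text \<open>Configurations of two pairs with exactly one common point, sorted by where \<infinity>
  occurs. The common point is written first.\<close>

lemma trivial_meet_points: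
  "x \<noteq> y \<Longrightarrow> trivial_meet {inf_pt, pt x} {inf_pt, pt y}"
  "x \<noteq> y \<Longrightarrow> trivial_meet {pt x, inf_pt} {pt x, pt y}"
  "x \<noteq> y \<Longrightarrow> trivial_meet {pt x, pt y} {pt x, inf_pt}"
  "x \<noteq> y \<Longrightarrow> x \<noteq> z \<Longrightarrow> y \<noteq> z \<Longrightarrow> trivial_meet {pt x, pt y} {pt x, pt z}"
  unfolding pt_def inf_pt_def by (rule trivial_meet_if_share_line; simp)+

lemma trivial_meet_affine:
  assumes "a \<noteq> b" "x \<noteq> y" "a \<noteq> x" "b \<noteq> x" "- ((a - x) * (a - y) * (b - x) * (b - y)) \<notin> range (\<lambda>x. x^2)"
  shows "trivial_meet {pt a, pt b} {pt x, pt y}"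
  unfolding pt_def by (rule trivial_meet_if_nonsquare) (use assms in simp_all)

lemma matrix2_mult_vector:
  "(vector [vector [a, b], vector [c, d]] :: 'a::comm_ring_1^2^2) *v vector [x, y] = vector [a * x + b * y, c * x + d * y]"
  by (simp add: vec_eq_iff forall_2 matrix_vector_mult_def sum_2)

text \<open>Acts on the projective line by x \<mapsto> t^2 x, and \<open>inversion t\<close> by x
  \<mapsto> -t^2/x. For \<open>t\<close> nonzero these are all the matrices of determinant 1 that
  stabilise {0, \<infinity>}.\<close>

definition dilation :: "'a::field \<Rightarrow> 'a^2^2" where
  "dilation t = vector [vector [t, 0], vector [0, 1 / t]]"

definition inversion :: "'a::field \<Rightarrow> 'a^2^2" where
  "inversion t = vector [vector [0, - t], vector [1 / t, 0]]"

lemma det_dilation: "t \<noteq> 0 \<Longrightarrow> det (dilation t) = 1"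
  by (simp add: det_2 dilation_def)

lemma det_inversion: "t \<noteq> 0 \<Longrightarrow> det (inversion t) = 1"
  by (simp add: det_2 inversion_def)

lemma dilation_image:
  assumes "t \<noteq> 0"
  shows "(*v) (dilation t) ` pt x = pt (t^2 * x)" "(*v) (dilation t) ` inf_pt = inf_pt"
  using assms by (simp_all add: pt_def inf_pt_def dilation_def matrix2_mult_vector line_eq_iff
      power2_eq_square field_simps)

lemma inversion_image:
  assumes "t \<noteq> 0"
  shows "x \<noteq> 0 \<Longrightarrow> (*v) (inversion t) ` pt x = pt (- (t^2 / x))"
    "(*v) (inversion t) ` pt 0 = inf_pt" "(*v) (inversion t) ` inf_pt = pt 0"
  using assms by (simp_all add: pt_def inf_pt_def inversion_def matrix2_mult_vector line_eq_iff
      power2_eq_square field_simps)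

section \<open>Orbits of the stabiliser of a decomposition\<close>

text \<open>Only 1 and -1 have square 1, so a fourth element suffices. This is where the bound on
  the order of the field enters.\<close>

lemma exists_unit_square_neq_1:
  assumes "CARD('a::{field,finite}) \<ge> 4"
  obtains t :: "'a::{field,finite}" where "t \<noteq> 0" "t^2 \<noteq> 1"
proof -
  have "card {0, 1, -1 :: 'a} < 4" by (simp add: card_insert_if)
  then have "{0, 1, -1 :: 'a} \<noteq> UNIV" using assms by (metis not_less)
  then obtain t :: 'a where "t \<notin> {0, 1, -1}" by blast
  then show thesis using that[of t] by (auto simp: power2_eq_1_iff)
qed

lemma move_dilation:
  assumes "t \<noteq> 0"
  shows "move (dilation t) {pt x, pt y} = {pt (t^2 * x), pt (t^2 * y)}"
    "move (dilation t) {inf_pt, pt x} = {inf_pt, pt (t^2 * x)}"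
  using assms by (simp_all add: move_def dilation_image)

lemma move_inversion:
  assumes "t \<noteq> 0"
  shows "x \<noteq> 0 \<Longrightarrow> y \<noteq> 0 \<Longrightarrow> move (inversion t) {pt x, pt y} = {pt (- (t^2 / x)), pt (- (t^2 / y))}"
    "x \<noteq> 0 \<Longrightarrow> move (inversion t) {pt 0, pt x} = {inf_pt, pt (- (t^2 / x))}"
    "x \<noteq> 0 \<Longrightarrow> move (inversion t) {inf_pt, pt x} = {pt 0, pt (- (t^2 / x))}"
    "move (inversion t) {inf_pt, pt 0} = {pt 0, inf_pt}"
  using assms by (simp_all add: move_def inversion_image)

lemma move_dilation_base: "t \<noteq> 0 \<Longrightarrow> move (dilation t) {inf_pt, pt 0} = {inf_pt, pt 0}"
  by (simp add: move_dilation)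

lemma move_inversion_base: "t \<noteq> 0 \<Longrightarrow> move (inversion t) {inf_pt, pt 0} = {inf_pt, pt 0}"
  by (simp add: move_inversion insert_commute)

lemma dilation_eq_scalar: "dilation t = mat c \<Longrightarrow> t \<noteq> 0 \<Longrightarrow> t^2 = 1"
  by (auto simp: dilation_def vec_eq_iff forall_2 mat_def power2_eq_square divide_eq_eq)

lemma inversion_neq_scalar: "t \<noteq> 0 \<Longrightarrow> inversion t \<noteq> mat c"
  by (simp add: inversion_def vec_eq_iff forall_2 mat_def)

text \<open>If \<open>- (c * d) = t^2\<close>, then \<open>inversion t\<close> swaps
  \<open>pt c\<close> and \<open>pt d\<close>; it also stabilises {0, \<infinity>} and is not
  scalar.\<close>

lemma nonsquare_if_trivial_meet:
  assumes "c \<noteq> 0" "d \<noteq> 0" and triv: "trivial_meet {inf_pt, pt 0} {pt c, pt d}"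
  shows "- (c * d) \<notin> range (\<lambda>x. x^2)"
proof
  assume "- (c * d) \<in> range (\<lambda>x. x^2)"
  then obtain t where t: "t^2 = - (c * d)" by fastforce
  then have "t \<noteq> 0" using assms by auto
  have "- (t^2 / c) = d" "- (t^2 / d) = c" using t assms by simp_all
  then have "move (inversion t) {pt c, pt d} = {pt d, pt c}"
    by (simp only: move_inversion(1)[OF \<open>t \<noteq> 0\<close> assms(1,2)])
  then have "move (inversion t) {pt c, pt d} = {pt c, pt d}" by (simp only: insert_commute)
  then have "\<exists>e. inversion t = mat e"
    using triv det_inversion[OF \<open>t \<noteq> 0\<close>] move_inversion_base[OF \<open>t \<noteq> 0\<close>] by (simp only: trivial_meet_def)
  then show False using inversion_neq_scalar[OF \<open>t \<noteq> 0\<close>] by blast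
qed

text \<open>Dilations reach the square multiples. For a nonsquare \<open>t\<close>, the product
  \<open>- (c * d) * t\<close> of two nonsquares is some \<open>s^2\<close>, and
  \<open>inversion s\<close> sends \<open>c\<close> to \<open>t * d\<close> and \<open>d\<close> to
  \<open>t * c\<close>.\<close>

lemma move_to_multiple:
  fixes c d t :: "'a::{field,finite}"
  assumes "c \<noteq> 0" "d \<noteq> 0" "t \<noteq> 0" and ns: "- (c * d) \<notin> range (\<lambda>x. x^2)"
  obtains M where "det M = 1" "move M {inf_pt, pt 0} = {inf_pt, pt 0}"
    "move M {pt c, pt d} = {pt (t * c), pt (t * d)}"
proof (cases "t \<in> range (\<lambda>x. x^2)")
  case True
  then obtain s where s: "t = s^2" by blast
  then have "s \<noteq> 0" using assms by auto
  have "move (dilation s) {pt c, pt d} = {pt (t * c), pt (t * d)}"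
    by (simp only: move_dilation(1)[OF \<open>s \<noteq> 0\<close>] s)
  then show thesis
    by (rule that[OF det_dilation[OF \<open>s \<noteq> 0\<close>] move_dilation_base[OF \<open>s \<noteq> 0\<close>]])
next
  case False
  then obtain s where s: "- (c * d) * t = s^2" using finite_field_nonsquares_mult[OF ns] by blast
  have "s \<noteq> 0"
  proof
    assume "s = 0"
    then show False using s assms(1-3) by simp
  qed
  have "- (s^2 / c) = t * d" "- (s^2 / d) = t * c" using assms(1,2) by (simp_all flip: s)
  then have "move (inversion s) {pt c, pt d} = {pt (t * d), pt (t * c)}"
    by (simp only: move_inversion(1)[OF \<open>s \<noteq> 0\<close> assms(1,2)])
  then have "move (inversion s) {pt c, pt d} = {pt (t * c), pt (t * d)}" by (simp only: insert_commute)
  then show thesis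
    by (rule that[OF det_inversion[OF \<open>s \<noteq> 0\<close>] move_inversion_base[OF \<open>s \<noteq> 0\<close>]])
qed

text \<open>Scaling by \<open>x / c\<close> puts any nonzero \<open>x\<close> into the moved pair,
  with partner \<open>x * d / c\<close>. If \<open>x\<close> lies in \<open>D\<close> and the
  partner does not, exactly one point is shared.\<close>

lemma trivial_meet_orbit_disjoint:
  fixes c d :: "'a::{field,finite}"
  assumes "c \<noteq> d" "c \<noteq> 0" "d \<noteq> 0" and triv: "trivial_meet {inf_pt, pt 0} {pt c, pt d}"
    and D: "D \<in> decompositions"
  shows "\<exists>M. det M = 1 \<and> move M {inf_pt, pt 0} = {inf_pt, pt 0} \<and> trivial_meet D (move M {pt c, pt d})"
proof -
  have ns: "- (c * d) \<notin> range (\<lambda>x. x^2)" using nonsquare_if_trivial_meet assms by blast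
  have *: ?thesis if "t \<noteq> 0" "trivial_meet D {pt (t * c), pt (t * d)}" for t
  proof -
    obtain M where "det M = 1" "move M {inf_pt, pt 0} = {inf_pt, pt 0}"
      "move M {pt c, pt d} = {pt (t * c), pt (t * d)}"
      using move_to_multiple[OF assms(2,3) \<open>t \<noteq> 0\<close> ns] .
    then show ?thesis using that(2) by (intro exI[of _ M]) simp
  qed
  have **: ?thesis if "x \<noteq> 0" "trivial_meet D {pt x, pt (x * d / c)}" for x
  proof (rule *)
    show "x / c \<noteq> 0" using that assms(2) by simp
    show "trivial_meet D {pt (x / c * c), pt (x / c * d)}" using that(2) assms(2) by simp
  qed
  have nx: "x \<noteq> x * d / c" "x * d / c \<noteq> 0" if "x \<noteq> 0" for x
  proof -
    show "x * d / c \<noteq> 0" using that assms by simp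
    show "x \<noteq> x * d / c" using that assms by (metis divide_eq_eq mult_cancel_left)
  qed
  from D show ?thesis
  proof (cases rule: decomposition_cases)
    case (1 x)
    show ?thesis
    proof (cases "x = 0")
      case True
      then show ?thesis using triv 1 by (intro exI[of _ "mat 1"]) simp
    next
      case False
      then have "trivial_meet {pt x, inf_pt} {pt x, pt (x * d / c)}" using trivial_meet_points(2) nx by blast
      then show ?thesis using **[OF False] 1 by (simp only: insert_commute)
    qed
  next
    case (2 x y)
    have share: ?thesis if "x \<noteq> 0" "y \<noteq> x" "y \<noteq> x * d / c" "D = {pt x, pt y}" for x y
      using **[of x] trivial_meet_points(4)[of x y "x * d / c"] nx that by metis
    \<comment> \<open>If each of \<open>x\<close>, \<open>y\<close> were the partner of the other,
      then \<open>(d / c)^2 = 1\<close>, so \<open>d = - c\<close> and \<open>- (c * d)\<close>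
      would be a square.\<close>
    have alt: "y \<noteq> x * d / c \<or> x \<noteq> y * d / c" if "x \<noteq> 0"
    proof (rule ccontr)
      assume "\<not> ?thesis"
      then have "x = x * d / c * d / c" by simp
      then have "x * c^2 = x * d^2" using assms(2)
        by (simp add: eq_divide_eq power2_eq_square mult_ac)
      then have "d^2 = c^2" using that by simp
      then have "d = - c" using assms(1) by (auto simp: power2_eq_iff)
      then have "- (c * d) = c^2" by (simp add: power2_eq_square)
      then show False using ns by blast
    qed
    show ?thesis
    proof (cases "x = 0 \<or> y = x * d / c")
      case True
      have "y \<noteq> 0" using True 2(1) nx(2)[of x] by metis
      moreover have "x \<noteq> y * d / c" using True alt nx(2)[OF \<open>y \<noteq> 0\<close>] by metis
      moreover have "D = {pt y, pt x}" using 2(2) by (simp only: insert_commute)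
      ultimately show ?thesis using share[of y x] 2(1) by metis
    next
      case False
      then show ?thesis using share[of x y] 2 by metis
    qed
  qed
qed

text \<open>Dilations yield the pairs {0, t^2 c}, inversions the pairs {\<infinity>, -t^2/c}. One of
  them shares exactly one point with \<open>D\<close> unless both points of \<open>D\<close>,
  divided by \<open>c\<close>, and their negatives are nonsquares; then the nonsquare criterion for
  disjoint pairs is used.\<close>

lemma trivial_meet_orbit_adjacent:
  fixes c :: "'a::{field,finite}"
  assumes card: "CARD('a) \<ge> 4" and "c \<noteq> 0" and D: "D \<in> decompositions"
  shows "\<exists>M. det M = 1 \<and> move M {inf_pt, pt 0} = {inf_pt, pt 0} \<and> trivial_meet D (move M {pt 0, pt c})"
proof -
  have dil: ?thesis if "t \<noteq> 0" "trivial_meet D {pt 0, pt (t^2 * c)}" for t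
  proof (intro exI conjI)
    show "trivial_meet D (move (dilation t) {pt 0, pt c})" using that by (simp add: move_dilation)
  qed (simp_all add: that det_dilation move_dilation_base)
  have inv: ?thesis if "t \<noteq> 0" "trivial_meet D {inf_pt, pt (- (t^2 / c))}" for t
  proof (intro exI conjI)
    show "trivial_meet D (move (inversion t) {pt 0, pt c})"
      using that \<open>c \<noteq> 0\<close> by (simp add: move_inversion)
  qed (simp_all add: that det_inversion move_inversion_base)
  obtain t0 :: 'a where t0: "t0 \<noteq> 0" "t0^2 \<noteq> 1" using exists_unit_square_neq_1[OF card] .
  from D show ?thesis
  proof (cases rule: decomposition_cases)
    case (1 x)
    \<comment> \<open>The parameters 1 and \<open>t0\<close> give two different candidates, and at
      most one of them equals \<open>x\<close>.\<close>
    have "- (1^2 / c) \<noteq> - (t0^2 / c)" using t0 \<open>c \<noteq> 0\<close> by simp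
    then obtain t where "t \<noteq> 0" "x \<noteq> - (t^2 / c)" using t0(1) by (metis zero_neq_one)
    then show ?thesis using inv trivial_meet_points(1) 1 by blast
  next
    case (2 x y)
    have zero: ?thesis if "D = {pt 0, pt y}" "y \<noteq> 0" for y
    proof -
      have "1^2 * c \<noteq> t0^2 * c" using t0 \<open>c \<noteq> 0\<close> by simp
      then obtain t where "t \<noteq> 0" "y \<noteq> t^2 * c" using t0(1) by (metis zero_neq_one)
      then show ?thesis using dil[of t] trivial_meet_points(4)[of 0 y "t^2 * c"] that \<open>c \<noteq> 0\<close> by simp
    qed
    have sq: ?thesis if "D = {pt x, pt y}" "y \<noteq> x" "y \<noteq> 0" "x \<noteq> 0" "x / c = t^2" for x y t
    proof -
      have "t \<noteq> 0" "x = t^2 * c" using that \<open>c \<noteq> 0\<close> by (auto simp: divide_eq_eq)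
      moreover have "trivial_meet {pt x, pt y} {pt 0, pt x}"
        using trivial_meet_points(4)[of x y 0] that by (metis insert_commute)
      ultimately show ?thesis using dil[of t] that(1) by metis
    qed
    have msq: ?thesis if "D = {pt x, pt y}" "y \<noteq> x" "x \<noteq> 0" "- (x / c) = t^2" for x y t
    proof -
      have "t \<noteq> 0" using that \<open>c \<noteq> 0\<close> by auto
      \<comment> \<open>Since \<open>x = - (t^2 * c)\<close>, the inversion with parameter
        \<open>t * c\<close> moves 0 to \<infinity> and \<open>c\<close> to
        \<open>x\<close>.\<close>
      have x: "x = - ((t * c)^2 / c)" using that(4) \<open>c \<noteq> 0\<close>
        by (simp add: power_mult_distrib flip: that(4)) (simp add: power2_eq_square)
      have "trivial_meet D {inf_pt, pt x}"
        using trivial_meet_points(3)[OF that(2)[symmetric]] that(1) by (simp only: insert_commute)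
      then show ?thesis using inv[of "t * c"] \<open>t \<noteq> 0\<close> \<open>c \<noteq> 0\<close> by (simp only: x[symmetric]) simp
    qed
    have D': "D = {pt y, pt x}" using 2(2) by (simp only: insert_commute)
    show ?thesis
    proof (cases "x = 0 \<or> y = 0")
      case True
      then show ?thesis using zero[of y] zero[of x] 2 D' by metis
    next
      case False
      show ?thesis
      proof (rule ccontr)
        assume neg: "\<not> ?thesis"
        \<comment> \<open>Division by \<open>c\<close> normalises to the case c = 1.\<close>
        define a where "a = x / c"
        define b where "b = y / c"
        have xy: "x = a * c" "y = b * c" using \<open>c \<noteq> 0\<close> by (simp_all add: a_def b_def)
        have ns: "a \<notin> range (\<lambda>x. x^2)" "b \<notin> range (\<lambda>x. x^2)" "- a \<notin> range (\<lambda>x. x^2)"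
          unfolding a_def b_def
          using neg sq[OF 2(2) 2(1)[symmetric]] sq[OF D' 2(1)] msq[OF 2(2) 2(1)[symmetric]] False by blast+
        have "a \<noteq> b" using 2 xy by auto
        have "a \<noteq> 0" using xy False by auto
        \<comment> \<open>Both \<open>a\<close> and \<open>- a\<close> are nonsquares, so their
          product is a square. This makes -1 a square, and \<open>i\<close> records it without a
          division.\<close>
        obtain i where i: "a * - a = i^2" using finite_field_nonsquares_mult[OF ns(1,3)] by blast
        obtain k where k: "a * b = k^2" using finite_field_nonsquares_mult[OF ns(1,2)] by blast
        obtain t where t: "t \<noteq> 0" "(t^2 - a) * (t^2 - b) \<notin> range (\<lambda>x. x^2)"
          using exists_square_with_nonsquare_product[OF \<open>a \<noteq> b\<close> ns(1,2)] .
        have "- ((x - 0) * (x - t^2 * c) * (y - 0) * (y - t^2 * c)) \<notin> range (\<lambda>x. x^2)"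
        proof
          assume "- ((x - 0) * (x - t^2 * c) * (y - 0) * (y - t^2 * c)) \<in> range (\<lambda>x. x^2)"
          then obtain z where z: "- ((x - 0) * (x - t^2 * c) * (y - 0) * (y - t^2 * c)) = z^2" by blast
          \<comment> \<open>The factor \<open>a^2\<close> brings in \<open>a * - a = i^2\<close>, so
            that everything except \<open>(t^2 - a) * (t^2 - b)\<close> is visibly a square.\<close>
          have "(a * z)^2 = a^2 * - ((x - 0) * (x - t^2 * c) * (y - 0) * (y - t^2 * c))"
            by (simp only: z power_mult_distrib)
          also have "\<dots> = (a * - a) * (a * b) * (c^2)^2 * ((t^2 - a) * (t^2 - b))"
            unfolding xy by (simp add: power2_eq_square algebra_simps)
          also have "\<dots> = (i * k * c^2)^2 * ((t^2 - a) * (t^2 - b))"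
            by (simp only: i k power_mult_distrib)
          finally have e: "(a * z)^2 = (i * k * c^2)^2 * ((t^2 - a) * (t^2 - b))" .
          have "i \<noteq> 0" "k \<noteq> 0" using i k \<open>a \<noteq> 0\<close> False xy by auto
          then have "(t^2 - a) * (t^2 - b) = (a * z / (i * k * c^2))^2"
            using e \<open>c \<noteq> 0\<close> unfolding power_divide[of "a * z"] by simp
          then show False using t(2) by blast
        qed
        then have "trivial_meet {pt x, pt y} {pt 0, pt (t^2 * c)}"
          using False 2 t(1) \<open>c \<noteq> 0\<close> by (intro trivial_meet_affine) auto
        then show False using dil t(1) 2 neg by blast
      qed
    qed
  qed
qed

text \<open>The pair \<open>X\<close> is not {0, \<infinity>} itself, since a nonscalar dilation
  stabilises that. So it contains one of 0, \<infinity> or neither, and the two preceding orbit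
  lemmas apply.\<close>

lemma trivial_meet_orbit_std:
  fixes D X :: "('a::{field,finite}^2) set set"
  assumes card: "CARD('a) \<ge> 4" and D: "D \<in> decompositions" and X: "X \<in> decompositions"
    and triv: "trivial_meet {inf_pt, pt 0} X"
  shows "\<exists>M. det M = 1 \<and> move M {inf_pt, pt 0} = {inf_pt, pt 0} \<and> trivial_meet D (move M X)"
  using X
proof (cases rule: decomposition_cases)
  case (1 c)
  have "c \<noteq> 0"
  proof
    assume "c = 0"
    obtain t :: 'a where t: "t \<noteq> 0" "t^2 \<noteq> 1" using exists_unit_square_neq_1[OF card] .
    have "\<exists>e. dilation t = mat e"
      using triv 1 \<open>c = 0\<close> det_dilation[OF t(1)] move_dilation_base[OF t(1)]
      by (simp only: trivial_meet_def)
    then show False using dilation_eq_scalar t by blast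
  qed
  \<comment> \<open>Exchanging 0 and \<infinity> reduces pairs through \<infinity> to pairs through
    0.\<close>
  have X': "move (inversion 1) X = {pt 0, pt (- (1 / c))}"
    using 1 \<open>c \<noteq> 0\<close> by (simp add: move_inversion)
  obtain M where M: "det M = 1" "move M {inf_pt, pt 0} = {inf_pt, pt 0}"
      "trivial_meet D (move M (move (inversion 1) X))"
    unfolding X' using trivial_meet_orbit_adjacent[OF card _ D, of "- (1 / c)"] \<open>c \<noteq> 0\<close> by auto
  then show ?thesis
    by (intro exI[of _ "M ** inversion 1"])
      (simp add: det_mul det_inversion move_inversion_base flip: move_move)
next
  case (2 c d)
  show ?thesis
  proof (cases "c = 0 \<or> d = 0")
    case True
    then obtain e where "e \<noteq> 0" "X = {pt 0, pt e}" using 2 by (metis insert_commute)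
    then show ?thesis using trivial_meet_orbit_adjacent[OF card _ D] by simp
  next
    case False
    then show ?thesis using trivial_meet_orbit_disjoint[of c d D] 2 triv D by simp
  qed
qed

section \<open>Transport from {0, \<infinity>} to an arbitrary decomposition\<close>

lemma det_1_inverse:
  fixes P :: "'a::comm_ring_1^2^2"
  assumes "det P = 1"
  obtains Q where "det Q = 1" "Q ** P = mat 1" "P ** Q = mat 1"
proof
  let ?Q = "vector [vector [P$2$2, - P$1$2], vector [- P$2$1, P$1$1]] :: 'a^2^2"
  show "det ?Q = 1" "?Q ** P = mat 1" "P ** ?Q = mat 1"
    using assms by (simp_all add: det_2 vec_eq_iff forall_2 matrix_matrix_mult_def sum_2 mat_def algebra_simps)
qed

text \<open>Conjugation by \<open>P\<close> carries one common stabiliser to the other and leaves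
  scalar matrices unchanged.\<close>

lemma trivial_meet_move:
  assumes "det P = 1" and triv: "trivial_meet D E"
  shows "trivial_meet (move P D) (move P E)"
  unfolding trivial_meet_def
proof (intro allI impI)
  fix A assume A: "det A = 1" "move A (move P D) = move P D" "move A (move P E) = move P E"
  obtain Q where Q: "det Q = 1" "Q ** P = mat 1" "P ** Q = mat 1" using det_1_inverse assms(1) .
  have "move (Q ** A ** P) F = F" if "move A (move P F) = move P F" for F
    using that Q(2) by (metis move_move move_one)
  moreover have "det (Q ** A ** P) = 1" using A(1) assms(1) Q(1) by (simp add: det_mul)
  ultimately obtain c where c: "Q ** A ** P = mat c"
    using triv A(2,3) by (metis trivial_meet_def)
  have "A = P ** (Q ** A ** P) ** Q"
    using Q(3) by (metis matrix_mul_assoc matrix_mul_lid matrix_mul_rid)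
  also have "\<dots> = mat c ** (P ** Q)"
    unfolding c by (simp add: vec_eq_iff forall_2 matrix_matrix_mult_def sum_2 mat_def algebra_simps)
  also have "\<dots> = mat c" by (simp add: Q)
  finally show "\<exists>c. A = mat c" by blast
qed

text \<open>\<open>SL2\<close> is transitive on decompositions: the matrix \<open>P\<close> with
  columns \<open>u\<close> and \<open>w\<close> moves {0, \<infinity>} to \<open>B\<close>. The
  standard case is conjugated by \<open>P\<close>.\<close>

lemma trivial_meet_orbit:
  fixes D B X :: "('a::{field,finite}^2) set set"
  assumes card: "CARD('a) \<ge> 4" and D: "D \<in> decompositions" and B: "B \<in> decompositions"
    and X: "X \<in> decompositions" and triv: "trivial_meet B X"
  obtains M where "det M = 1" "move M B = B" "trivial_meet D (move M X)"
proof -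
  obtain u v where uv: "wedge u v \<noteq> 0" "B = {line u, line v}" using B decompositions_iff by blast
  \<comment> \<open>Rescaling \<open>v\<close> keeps its line and gives \<open>P\<close> determinant
    1.\<close>
  define w where "w = (1 / wedge u v) *s v"
  define P :: "'a^2^2" where "P = vector [vector [u$1, w$1], vector [u$2, w$2]]"
  have "line w = line v" using uv(1) by (simp add: w_def line_scale)
  have "wedge u w = 1" using uv(1) by (simp add: w_def)
  then have "det P = 1" by (simp add: P_def det_2 wedge_def mult.commute)
  have "P *v vector [1, 0] = u" "P *v vector [0, 1] = w"
    by (simp_all add: P_def vec_eq_iff forall_2 matrix_vector_mult_def sum_2)
  then have PB: "move P {inf_pt, pt 0} = B"
    using \<open>line w = line v\<close> by (simp add: uv inf_pt_def pt_def)
  obtain Q where Q: "Q ** P = mat 1" "P ** Q = mat 1" and "det Q = 1" using det_1_inverse \<open>det P = 1\<close> .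
  have cancel: "move Q (move P F) = F" "move P (move Q F) = F" for F
    by (simp_all add: move_move Q)
  have "trivial_meet {inf_pt, pt 0} (move Q X)"
    using trivial_meet_move[OF \<open>det Q = 1\<close> triv] PB cancel(1) by metis
  from trivial_meet_orbit_std[OF card move_decompositions[OF \<open>det Q = 1\<close> D]
      move_decompositions[OF \<open>det Q = 1\<close> X] this]
  obtain M where M: "det M = 1" "move M {inf_pt, pt 0} = {inf_pt, pt 0}"
      "trivial_meet (move Q D) (move M (move Q X))"
    by blast
  show thesis
  proof (rule that[of "P ** M ** Q"])
    show "det (P ** M ** Q) = 1" using M \<open>det P = 1\<close> \<open>det Q = 1\<close> by (simp add: det_mul)
    show "move (P ** M ** Q) B = B" using M(2) PB cancel(1) by (metis move_move)
    show "trivial_meet D (move (P ** M ** Q) X)"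
      using trivial_meet_move[OF \<open>det P = 1\<close> M(3)] cancel(2) by (simp flip: move_move)
  qed
qed

section \<open>Group actions on cosets\<close>

lemma (in group) centre_normal: "centre G \<lhd> G"
proof (rule normalI)
  have cen: "a \<in> carrier G" "g \<in> carrier G \<Longrightarrow> a \<otimes> g = g \<otimes> a" if "a \<in> centre G" for a g
    using that unfolding centre_def by blast+
  have cenI: "a \<in> centre G" if "a \<in> carrier G" "\<And>g. g \<in> carrier G \<Longrightarrow> a \<otimes> g = g \<otimes> a" for a
    using that unfolding centre_def by blast
  show "subgroup (centre G) G"
  proof (rule subgroupI)
    show "centre G \<noteq> {}" using cenI[of \<one>] by fastforce
    show "centre G \<subseteq> carrier G" using cen(1) by blast
  next
    fix a assume a: "a \<in> centre G"
    have "inv a \<otimes> g = g \<otimes> inv a" if "g \<in> carrier G" for g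
    proof -
      have "inv a \<otimes> g = inv a \<otimes> (g \<otimes> a) \<otimes> inv a" using cen(1)[OF a] that by (simp add: m_assoc)
      also have "g \<otimes> a = a \<otimes> g" using cen(2)[OF a that] by (rule sym)
      also have "inv a \<otimes> (a \<otimes> g) = g"
        using m_assoc[of "inv a" a g] cen(1)[OF a] that by simp
      finally show ?thesis .
    qed
    then show "inv a \<in> centre G" using cenI cen(1)[OF a] by blast
  next
    fix a b assume a: "a \<in> centre G" and b: "b \<in> centre G"
    have "a \<otimes> b \<otimes> g = g \<otimes> (a \<otimes> b)" if g: "g \<in> carrier G" for g
    proof -
      note car = cen(1)[OF a] cen(1)[OF b]
      have "a \<otimes> b \<otimes> g = a \<otimes> (b \<otimes> g)" by (rule m_assoc[OF car g])
      also have "\<dots> = a \<otimes> g \<otimes> b"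
        unfolding cen(2)[OF b g] by (rule m_assoc[OF car(1) g car(2), symmetric])
      also have "\<dots> = g \<otimes> (a \<otimes> b)" unfolding cen(2)[OF a g] by (rule m_assoc[OF g car])
      finally show ?thesis .
    qed
    then show "a \<otimes> b \<in> centre G" using cenI m_closed cen(1)[OF a] cen(1)[OF b] by blast
  qed
  show "\<forall>x\<in>carrier G. centre G #> x = x <# centre G"
  proof
    fix x assume x: "x \<in> carrier G"
    show "centre G #> x = x <# centre G"
      unfolding r_coset_def l_coset_def by (rule SUP_cong[OF refl]) (simp only: cen(2)[OF _ x])
  qed
qed

text \<open>Well-definedness and injectivity in the orbit-stabiliser correspondence, which turns
  cosets into points of \<open>E\<close>.\<close>

lemma (in group_action) lcoset_stabilizer_eq_iff:
  assumes "x \<in> E" "a \<in> carrier G" "b \<in> carrier G"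
  shows "a <# stabilizer G \<phi> x = b <# stabilizer G \<phi> x \<longleftrightarrow> \<phi> a x = \<phi> b x"
proof -
  interpret group G using group_hom group_hom.axioms(1) by auto
  have sub: "subgroup (stabilizer G \<phi> x) G" using assms(1) by (rule stabilizer_subgroup)
  show ?thesis
  proof
    assume "a <# stabilizer G \<phi> x = b <# stabilizer G \<phi> x"
    then have "a \<in> b <# stabilizer G \<phi> x" using lcos_self[OF assms(2) sub] by simp
    then obtain h where "h \<in> stabilizer G \<phi> x" "a = b \<otimes> h" by (auto simp: l_coset_def)
    then show "\<phi> a x = \<phi> b x" using composition_rule assms by (auto simp: stabilizer_def)
  next
    assume eq: "\<phi> a x = \<phi> b x"
    have "\<phi> (inv b \<otimes> a) x = x" using assms eq composition_rule orbit_sym_aux by simp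
    then have "inv b \<otimes> a \<in> stabilizer G \<phi> x" using assms by (simp add: stabilizer_def)
    moreover have "a = b \<otimes> (inv b \<otimes> a)" using assms by (simp flip: m_assoc)
    ultimately have "a \<in> b <# stabilizer G \<phi> x" unfolding l_coset_def by blast
    then show "a <# stabilizer G \<phi> x = b <# stabilizer G \<phi> x"
      using l_repr_independence[OF _ assms(3) sub] by simp
  qed
qed

lemma (in group_action) coset_act_lcoset:
  assumes "x \<in> E" "g \<in> carrier G" "a \<in> carrier G"
  shows "coset_act G (stabilizer G \<phi> x) g (a <# stabilizer G \<phi> x) = (g \<otimes> a) <# stabilizer G \<phi> x"
proof -
  interpret group G using group_hom group_hom.axioms(1) by auto
  have "a <# stabilizer G \<phi> x \<in> lcosets stabilizer G \<phi> x" using assms(3) by (auto simp: LCOSETS_def)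
  then show ?thesis using assms stabilizer_subset by (simp add: coset_act_def lcos_m_assoc)
qed

lemma (in group_action) stabilizer_coset_act:
  assumes "x \<in> E" "a \<in> carrier G"
  shows "stabilizer G (coset_act G (stabilizer G \<phi> x)) (a <# stabilizer G \<phi> x) = stabilizer G \<phi> (\<phi> a x)"
proof -
  interpret group G using group_hom group_hom.axioms(1) by auto
  have "coset_act G (stabilizer G \<phi> x) g (a <# stabilizer G \<phi> x) = a <# stabilizer G \<phi> x
      \<longleftrightarrow> \<phi> g (\<phi> a x) = \<phi> a x" if "g \<in> carrier G" for g
    using lcoset_stabilizer_eq_iff[OF assms(1) m_closed[OF that assms(2)] assms(2)] that assms
    by (simp only: coset_act_lcoset composition_rule)
  then show ?thesis
    unfolding stabilizer_def[of G "coset_act G (stabilizer G \<phi> x)"] stabilizer_def[of G \<phi> "\<phi> a x"] by blast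
qed

text \<open>Separates the coset formalism from the geometry. A regular orbit of the stabiliser of
  \<beta> consists of cosets whose stabilisers meet that of \<beta> trivially, and
  \<open>key\<close> then moves one of them to a neighbour of \<alpha>.\<close>

lemma (in group_action) saxl_nbrs_meet_regular_orbits:
  assumes x: "x \<in> E"
    and key: "\<And>a b c. a \<in> E \<Longrightarrow> b \<in> E \<Longrightarrow> c \<in> E \<Longrightarrow> stabilizer G \<phi> b \<inter> stabilizer G \<phi> c = {\<one>} \<Longrightarrow>
      \<exists>g \<in> stabilizer G \<phi> b. stabilizer G \<phi> a \<inter> stabilizer G \<phi> (\<phi> g c) = {\<one>}"
    and H: "H = stabilizer G \<phi> x"
    and \<alpha>: "\<alpha> \<in> lcosets H" and \<beta>: "\<beta> \<in> lcosets H"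
    and R: "R \<in> regular_orbits (point_stabilizer G (coset_act G H) \<beta>) (lcosets H) (coset_act G H)"
  shows "saxl_nbrs G (lcosets H) (coset_act G H) \<alpha> \<inter> R \<noteq> {}"
proof -
  interpret group G using group_hom group_hom.axioms(1) by auto
  let ?act = "coset_act G H"
  obtain a where a: "a \<in> carrier G" "\<alpha> = a <# H" using \<alpha> by (auto simp: LCOSETS_def)
  obtain b where b: "b \<in> carrier G" "\<beta> = b <# H" using \<beta> by (auto simp: LCOSETS_def)
  have stab: "stabilizer G ?act (g <# H) = stabilizer G \<phi> (\<phi> g x)" if "g \<in> carrier G" for g
    using stabilizer_coset_act[OF x that] H by simp
  let ?B = "stabilizer G \<phi> (\<phi> b x)"
  obtain \<gamma> where \<gamma>: "\<gamma> \<in> lcosets H" "R = {?act g \<gamma> | g. g \<in> ?B}"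
    using R by (auto simp: regular_orbits_def orbits_def orbit_def point_stabilizer_def b(2) stab[OF b(1)])
  obtain c where c: "c \<in> carrier G" "\<gamma> = c <# H" using \<gamma> by (auto simp: LCOSETS_def)
  have one: "\<one> \<in> ?B" using stabilizer_one_closed element_image b(1) x by blast
  have "?act \<one> \<gamma> = \<gamma>" using coset_act_lcoset[OF x one_closed c(1)] c H by simp
  then have "\<gamma> \<in> R" using one \<gamma>(2) by force
  \<comment> \<open>Regularity applied to \<gamma> and itself: only the identity of the stabiliser
    of \<beta> fixes \<gamma>.\<close>
  then have unique: "\<exists>!g. g \<in> ?B \<and> ?act g \<gamma> = \<gamma>"
    using R by (auto simp: regular_orbits_def point_stabilizer_def b(2) stab[OF b(1)])
  have "g = \<one>" if "g \<in> ?B" "g \<in> stabilizer G \<phi> (\<phi> c x)" for g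
  proof -
    have "?act g \<gamma> = \<gamma>" using that(2) unfolding stab[OF c(1), symmetric] c(2) by (simp add: stabilizer_def)
    then show ?thesis using unique that(1) one \<open>?act \<one> \<gamma> = \<gamma>\<close> by blast
  qed
  moreover have E: "\<phi> a x \<in> E" "\<phi> b x \<in> E" "\<phi> c x \<in> E" using element_image x a(1) b(1) c(1) by blast+
  ultimately have "?B \<inter> stabilizer G \<phi> (\<phi> c x) = {\<one>}" using stabilizer_one_closed by blast
  then obtain g where g: "g \<in> ?B" "stabilizer G \<phi> (\<phi> a x) \<inter> stabilizer G \<phi> (\<phi> g (\<phi> c x)) = {\<one>}"
    using key E by blast
  have gG: "g \<in> carrier G" using g(1) stabilizer_subset by blast
  have eq: "?act g \<gamma> = (g \<otimes> c) <# H" using coset_act_lcoset[OF x gG c(1)] c(2) H by simp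
  have "stabilizer G ?act (?act g \<gamma>) = stabilizer G \<phi> (\<phi> g (\<phi> c x))"
    unfolding eq using stab gG c(1) composition_rule[OF x gG c(1)] by simp
  moreover have "(g \<otimes> c) <# H \<in> lcosets H" using gG c(1) by (auto simp: LCOSETS_def)
  ultimately have "?act g \<gamma> \<in> saxl_nbrs G (lcosets H) ?act \<alpha>"
    using g(2) by (simp add: saxl_nbrs_def a(2) stab[OF a(1)] eq)
  moreover have "?act g \<gamma> \<in> R" using g(1) \<gamma>(2) by blast
  ultimately show ?thesis by blast
qed

section \<open>The group PSL2\<close>

lemma SL2_simps [simp]:
  "carrier SL2 = {A. det A = 1}" "A \<otimes>\<^bsub>SL2\<^esub> B = A ** B" "\<one>\<^bsub>SL2\<^esub> = mat 1"
  by (simp_all add: SL2_def)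

lemma group_SL2: "group (SL2 :: ('a::{field,finite}^2^2) monoid)"
proof (rule groupI)
  fix A :: "'a^2^2" assume "A \<in> carrier SL2"
  then have "det A = 1" by simp
  from det_1_inverse[OF this] obtain B where "det B = 1" "B ** A = mat 1" by metis
  then show "\<exists>B\<in>carrier SL2. B \<otimes>\<^bsub>SL2\<^esub> A = \<one>\<^bsub>SL2\<^esub>" by (intro bexI[of _ B]) simp_all
qed (simp_all add: det_mul matrix_mul_assoc)

text \<open>Commuting with the two transvections \<open>U\<close> and \<open>L\<close> already
  forces a matrix to be scalar; the determinant then gives \<open>c^2 = 1\<close>.\<close>

lemma centre_SL2: "centre SL2 = {mat c | c. c^2 = (1::'a::{field,finite})}"
proof
  show "centre SL2 \<subseteq> {mat c | c. c^2 = (1::'a)}"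
  proof
    fix A :: "'a^2^2" assume A: "A \<in> centre SL2"
    define U :: "'a^2^2" where "U = vector [vector [1, 1], vector [0, 1]]"
    define L :: "'a^2^2" where "L = vector [vector [1, 0], vector [1, 1]]"
    have "det U = 1" "det L = 1" by (simp_all add: U_def L_def det_2)
    then have "A ** U = U ** A" "A ** L = L ** A" using A by (simp_all add: centre_def)
    then have "A$2$1 = 0" "A$1$1 = A$2$2" "A$1$2 = 0"
      by (auto simp: U_def L_def vec_eq_iff forall_2 matrix_matrix_mult_def sum_2)
    then have "A = mat (A$1$1)" by (simp add: vec_eq_iff forall_2 mat_def)
    moreover have "(A$1$1)^2 = 1"
      using A \<open>A$2$1 = 0\<close> \<open>A$1$1 = A$2$2\<close> by (simp add: centre_def det_2 power2_eq_square)
    ultimately show "A \<in> {mat c | c. c^2 = 1}" by blast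
  qed
  show "{mat c | c. c^2 = (1::'a)} \<subseteq> centre SL2"
    by (auto simp: centre_def det_2 mat_def power2_eq_square vec_eq_iff forall_2 matrix_matrix_mult_def sum_2
        mult.commute)
qed

text \<open>The quotient map from \<open>SL2\<close> to \<open>PSL2\<close> on matrices of
  determinant 1.\<close>

definition proj :: "'a::{field,finite}^2^2 \<Rightarrow> ('a^2^2) set" where
  "proj A = centre SL2 #>\<^bsub>SL2\<^esub> A"

lemma group_PSL2: "group (PSL2 :: ('a::{field,finite}^2^2) set monoid)"
  unfolding PSL2_def by (rule normal.factorgroup_is_group[OF group.centre_normal[OF group_SL2]])

lemma carrier_PSL2: "carrier PSL2 = proj ` {A. det A = 1}"
  by (auto simp: PSL2_def FactGroup_def RCOSETS_def proj_def)

lemma proj_mult: "det A = 1 \<Longrightarrow> det B = 1 \<Longrightarrow> proj A \<otimes>\<^bsub>PSL2\<^esub> proj B = proj (A ** B)"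
  using normal.rcos_sum[OF group.centre_normal[OF group_SL2], of A B]
  by (simp add: PSL2_def FactGroup_def proj_def)

lemma proj_eq_one_iff:
  fixes A :: "'a::{field,finite}^2^2"
  assumes "det A = 1"
  shows "proj A = \<one>\<^bsub>PSL2\<^esub> \<longleftrightarrow> (\<exists>c. A = mat c)"
proof -
  have sub: "subgroup (centre SL2) (SL2 :: ('a^2^2) monoid)"
    by (rule normal_imp_subgroup[OF group.centre_normal[OF group_SL2]])
  have A: "A \<in> carrier SL2" using assms by simp
  have "proj A = \<one>\<^bsub>PSL2\<^esub> \<longleftrightarrow> centre SL2 #>\<^bsub>SL2\<^esub> A = centre SL2"
    by (simp add: PSL2_def FactGroup_def proj_def)
  also have "\<dots> \<longleftrightarrow> A \<in> centre SL2"
    using group.coset_join1[OF group_SL2 _ A sub] group.coset_join2[OF group_SL2 A sub] by blast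
  also have "\<dots> \<longleftrightarrow> (\<exists>c. A = mat c)"
    using assms by (auto simp: centre_SL2 det_2 mat_def power2_eq_square)
  finally show ?thesis .
qed

text \<open>The representatives of the coset are the multiples of \<open>A\<close> by scalars of
  square 1, and nonzero scalars do not change a line.\<close>

lemma subspace_act_proj: "subspace_act (proj A) (line u) = line (A *v u)"
proof -
  have "(*v) (mat c ** A) ` line u = line (A *v u)" if "c^2 = 1" for c :: 'a
  proof -
    have "c \<noteq> 0" using that by auto
    moreover have "(mat c ** A) *v u = c *s (A *v u)"
      by (simp add: vec_eq_iff forall_2 matrix_vector_mult_def matrix_matrix_mult_def sum_2 mat_def algebra_simps)
    ultimately show ?thesis by (simp add: line_scale)
  qed
  moreover have "subspace_act (proj A) (line u) = (\<Union>c\<in>{c. c^2 = 1}. (*v) (mat c ** A) ` line u)"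
    by (auto simp: subspace_act_def proj_def r_coset_def centre_SL2)
  moreover have "\<exists>c::'a. c^2 = 1" by (rule exI[of _ 1]) simp
  ultimately show ?thesis by auto
qed

lemma decomp_act_proj:
  assumes "D \<in> decompositions"
  shows "decomp_act (proj A) D = move A D"
proof -
  obtain u v where "D = {line u, line v}" using assms decompositions_iff by blast
  then show ?thesis using assms by (simp add: decomp_act_def subspace_act_proj)
qed

lemma group_action_PSL2:
  "group_action PSL2 (decompositions :: ('a::{field,finite}^2) set set set) decomp_act"
proof -
  have Bij: "decomp_act (proj A) \<in> Bij decompositions" if A: "det A = 1" for A :: "'a^2^2"
  proof -
    obtain B where B: "det B = 1" "B ** A = mat 1" "A ** B = mat 1" using det_1_inverse[OF A] .
    have "bij_betw (decomp_act (proj A)) decompositions decompositions"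
      by (rule bij_betw_byWitness[where f' = "decomp_act (proj B)"])
        (auto simp: decomp_act_proj move_decompositions A B move_move)
    then show ?thesis by (simp add: Bij_def decomp_act_def)
  qed
  have "decomp_act \<in> hom PSL2 (BijGroup (decompositions :: ('a^2) set set set))"
  proof (rule homI)
    fix g h :: "('a^2^2) set" assume "g \<in> carrier PSL2" "h \<in> carrier PSL2"
    then obtain A B where AB: "g = proj A" "det A = 1" "h = proj B" "det B = 1"
      by (auto simp: carrier_PSL2)
    have "decomp_act (g \<otimes>\<^bsub>PSL2\<^esub> h) = compose decompositions (decomp_act g) (decomp_act h)"
    proof
      fix D :: "('a^2) set set"
      show "decomp_act (g \<otimes>\<^bsub>PSL2\<^esub> h) D = compose decompositions (decomp_act g) (decomp_act h) D"
      proof (cases "D \<in> decompositions")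
        case True
        then show ?thesis
          by (simp add: AB proj_mult decomp_act_proj compose_eq move_decompositions move_move)
      \<comment> \<open>Outside \<open>decompositions\<close> both sides are
        \<open>undefined\<close>, by the restriction in \<open>decomp_act\<close> and in
        \<open>compose\<close>.\<close>
      qed (simp add: decomp_act_def compose_def)
    qed
    then show "decomp_act (g \<otimes>\<^bsub>PSL2\<^esub> h) = decomp_act g \<otimes>\<^bsub>BijGroup decompositions\<^esub> decomp_act h"
      using Bij AB by (simp add: BijGroup_def)
  qed (use Bij in \<open>auto simp: carrier_PSL2 BijGroup_def\<close>)
  then show ?thesis
    by (simp add: group_action_def group_hom_def group_hom_axioms_def group_PSL2 group_BijGroup)
qed

lemma proj_mem_stabilizer_iff:
  "D \<in> decompositions \<Longrightarrow> det A = 1 \<Longrightarrow> proj A \<in> stabilizer PSL2 decomp_act D \<longleftrightarrow> move A D = D"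
  by (auto simp: stabilizer_def carrier_PSL2 decomp_act_proj)

text \<open>Every element of \<open>PSL2\<close> is \<open>proj A\<close> with
  \<open>det A = 1\<close>, and it is the identity exactly for scalar \<open>A\<close>. This links
  the matrix results to the group action.\<close>

lemma stabilizers_meet_trivially_iff:
  fixes D E :: "('a::{field,finite}^2) set set"
  assumes "D \<in> decompositions" "E \<in> decompositions"
  shows "stabilizer PSL2 decomp_act D \<inter> stabilizer PSL2 decomp_act E = {\<one>\<^bsub>PSL2\<^esub>} \<longleftrightarrow> trivial_meet D E"
    (is "?S = _ \<longleftrightarrow> _")
proof -
  have "\<one>\<^bsub>PSL2\<^esub> \<in> ?S"
    using group_action.stabilizer_one_closed[OF group_action_PSL2] assms by blast
  moreover have "?S \<subseteq> proj ` {A. det A = 1}" by (auto simp: stabilizer_def carrier_PSL2)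
  ultimately have "?S = {\<one>\<^bsub>PSL2\<^esub>} \<longleftrightarrow> (\<forall>A. det A = 1 \<longrightarrow> proj A \<in> ?S \<longrightarrow> proj A = \<one>\<^bsub>PSL2\<^esub>)"
    by blast
  also have "\<dots> \<longleftrightarrow> trivial_meet D E"
    unfolding trivial_meet_def by (simp add: proj_mem_stabilizer_iff proj_eq_one_iff assms imp_conjL cong: imp_cong)
  finally show ?thesis .
qed

theorem proposition5p12:
  fixes H :: "('a::{field,finite}^2^2) set set"
    and \<Omega> :: "('a^2^2) set set set"
    and act :: "('a^2^2) set \<Rightarrow> ('a^2^2) set set \<Rightarrow> ('a^2^2) set set"
  assumes "CARD('a) \<ge> 4"
    and "GL1_wr_S2_type H"
    and "\<Omega> = lcosets\<^bsub>PSL2\<^esub> H"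
    and "act = coset_act PSL2 H"
  shows "\<forall>\<alpha> \<in> \<Omega>. \<forall>\<beta> \<in> \<Omega>. \<forall>R \<in> regular_orbits (point_stabilizer PSL2 act \<beta>) \<Omega> act.
           saxl_nbrs PSL2 \<Omega> act \<alpha> \<inter> R \<noteq> {}"
proof -
  obtain D0 where D0: "D0 \<in> decompositions" "H = stabilizer PSL2 decomp_act D0"
    using assms(2) by (auto simp: GL1_wr_S2_type_def)
  \<comment> \<open>The geometric input of the coset reduction, obtained from
    \<open>trivial_meet_orbit\<close> by passing to matrices and back.\<close>
  have key: "\<exists>g \<in> stabilizer PSL2 decomp_act B.
      stabilizer PSL2 decomp_act D \<inter> stabilizer PSL2 decomp_act (decomp_act g X) = {\<one>\<^bsub>PSL2\<^esub>}"
    if DBX: "D \<in> decompositions" "B \<in> decompositions" "X \<in> decompositions"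
      and reg: "stabilizer PSL2 decomp_act B \<inter> stabilizer PSL2 decomp_act X = {\<one>\<^bsub>PSL2\<^esub>}"
    for D B X :: "('a^2) set set"
  proof -
    have "trivial_meet B X" using reg stabilizers_meet_trivially_iff[OF DBX(2,3)] by simp
    from trivial_meet_orbit[OF assms(1) DBX this] obtain M
      where M: "det M = 1" "move M B = B" "trivial_meet D (move M X)" .
    show ?thesis
    proof
      show "proj M \<in> stabilizer PSL2 decomp_act B"
        using M(1,2) proj_mem_stabilizer_iff[OF DBX(2)] by blast
      show "stabilizer PSL2 decomp_act D \<inter> stabilizer PSL2 decomp_act (decomp_act (proj M) X) = {\<one>\<^bsub>PSL2\<^esub>}"
        using M(3) stabilizers_meet_trivially_iff[OF DBX(1) move_decompositions[OF M(1) DBX(3)]]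
        by (simp add: decomp_act_proj DBX(3))
    qed
  qed
  show ?thesis
    unfolding assms(3,4)
    using group_action.saxl_nbrs_meet_regular_orbits[OF group_action_PSL2 D0(1) key D0(2)] by blast
qed

end
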